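(* Let $f:(X,r)\to(Y,s)$ be a morphism of biquandles and let $k$ be a positive integer. Then $f$ is also a morphism between the $k$-cabled biquandles $(X,r^{(k)})$ and $(Y,s^{(k)})$.
   Context: "Solution" means finite bijective non-degenerate set-theoretic solution of the Yang--Baxter equation: a pair $(X,r)$ with $X$ a non-empty finite set and $r:X\times X\to X\times X$, $r(x,y)=(\lambda_x(y),\rho_y(x))$, a bijection such that $(r\times \mathrm{id}_X)(\mathrm{id}_X\times r)(r\times \mathrm{id}_X)=(\mathrm{id}_X\times r)(r\times \mathrm{id}_X)(\mathrm{id}_X\times r)$ and all maps $\lambda_x,\rho_x:X\to X$ are bijective. A morphism $f:(X,r)\to(Y,s)$ is a map $f:X\to Y$ with $(f\times f)r=s(f\times f)$. Put $\sigma_y(x)=\lambda_y(\rho_{\lambda_x^{-1}(y)}(x))$; $(X,r)$ is a biquandle if $\sigma_x(x)=x$ for all $x\in X$ (i.e. its derived rack $x\triangleleft y=\sigma_y(x)$ is a quandle). The Yang--Baxter monoid is $M(X,r)=(M,\circ)=\langle x\in X\mid x\circ y=\lambda_x(y)\circ\rho_y(x)\rangle$, and $A(X,r)=\langle x\in X\mid x\oplus y=y\oplus\sigma_y(x)\rangle$; $X$ embeds in both. The map $r$ extends uniquely to a set-theoretic solution $r_M(a,b)=(\lambda_a(b),\rho_b(a))$ on $M$ with $a\circ b=\lambda_a(b)\circ\rho_b(a)$, $\lambda_{a\circ b}=\lambda_a\lambda_b$, $\rho_{a\circ b}=\rho_b\rho_a$, $\lambda_a(b\circ c)=\lambda_a(b)\circ\lambda_{\rho_b(a)}(c)$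 and $\rho_c(a\circ b)=\rho_{\lambda_b(c)}(a)\circ\rho_c(b)$. Moreover $\lambda$ induces an action of $M(X,r)$ on $A(X,r)$ by automorphisms, and $\mathrm{id}_X$ extends to a bijective 1-cocycle $\pi:M(X,r)\to A(X,r)$; set $a+b=\pi^{-1}(\pi(a)\oplus\pi(b))$, so that $(M,+)\cong A(X,r)$ and $a\circ b=a+\lambda_a(b)$. For $x\in X$, $kx$ is the $k$-fold sum of $x$ in $(M,+)$. For a biquandle $(X,r)$ and a positive integer $k$, the set $kX=\{kx\mid x\in X\}$ satisfies $r_M(kX\times kX)= kX\times kX$, and $\varphi:X\to kX$, $\varphi(x)=kx$, is a bijection. The $k$-cabled solution of $(X,r)$ is $(X,r^{(k)})$ with $r^{(k)}=(\varphi^{-1}\times\varphi^{-1})\,r_M|_{kX\times kX}\,(\varphi\times\varphi)$; it is again a biquandle. *)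

theory Defs
  imports "HOL-Algebra.Group"
begin

text \<open>A map \<open>r\<close> on \<open>X \<times> X\<close> is written \<open>r (x, y) = (lam r x y, rho r y x)\<close>, that is
  \<open>lam r x = \<lambda>\<^sub>x\<close> and \<open>rho r y = \<rho>\<^sub>y\<close>. The values of \<open>r\<close> outside \<open>X \<times> X\<close> are irrelevant.\<close>

definition lam :: "('a \<times> 'a \<Rightarrow> 'a \<times> 'a) \<Rightarrow> 'a \<Rightarrow> 'a \<Rightarrow> 'a" where
  "lam r x y = fst (r (x, y))"

definition rho :: "('a \<times> 'a \<Rightarrow> 'a \<times> 'a) \<Rightarrow> 'a \<Rightarrow> 'a \<Rightarrow> 'a" where
  "rho r y x = snd (r (x, y))"

definition braid12 :: "('a \<times> 'a \<Rightarrow> 'a \<times> 'a) \<Rightarrow> 'a \<times> 'a \<times> 'a \<Rightarrow> 'a \<times> 'a \<times> 'a" where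
  "braid12 r = (\<lambda>(x, y, z). case r (x, y) of (u, v) \<Rightarrow> (u, v, z))"

definition braid23 :: "('a \<times> 'a \<Rightarrow> 'a \<times> 'a) \<Rightarrow> 'a \<times> 'a \<times> 'a \<Rightarrow> 'a \<times> 'a \<times> 'a" where
  "braid23 r = map_prod id r"

definition solution :: "'a set \<Rightarrow> ('a \<times> 'a \<Rightarrow> 'a \<times> 'a) \<Rightarrow> bool" where
  "solution X r \<longleftrightarrow>
     finite X \<and> X \<noteq> {} \<and>
     bij_betw r (X \<times> X) (X \<times> X) \<and>
     (\<forall>t \<in> X \<times> X \<times> X. braid12 r (braid23 r (braid12 r t)) = braid23 r (braid12 r (braid23 r t))) \<and>
     (\<forall>x \<in> X. bij_betw (lam r x) X X) \<and>
     (\<forall>y \<in> X. bij_betw (rho r y) X X)"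

definition morphism ::
  "'a set \<Rightarrow> ('a \<times> 'a \<Rightarrow> 'a \<times> 'a) \<Rightarrow> 'b set \<Rightarrow> ('b \<times> 'b \<Rightarrow> 'b \<times> 'b) \<Rightarrow> ('a \<Rightarrow> 'b) \<Rightarrow> bool" where
  "morphism X r Y s f \<longleftrightarrow>
     f \<in> X \<rightarrow> Y \<and> (\<forall>p \<in> X \<times> X. map_prod f f (r p) = s (map_prod f f p))"

text \<open>\<open>sigma X r y x = \<sigma>\<^sub>y(x)\<close>\<close>

definition sigma :: "'a set \<Rightarrow> ('a \<times> 'a \<Rightarrow> 'a \<times> 'a) \<Rightarrow> 'a \<Rightarrow> 'a \<Rightarrow> 'a" where
  "sigma X r y x = lam r y (rho r (inv_into X (lam r x) y) x)"

definition biquandle :: "'a set \<Rightarrow> ('a \<times> 'a \<Rightarrow> 'a \<times> 'a) \<Rightarrow> bool" where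
  "biquandle X r \<longleftrightarrow> solution X r \<and> (\<forall>x \<in> X. sigma X r x x = x)"

inductive_set word_cong :: "'a set \<Rightarrow> ('a list \<times> 'a list) set \<Rightarrow> ('a list \<times> 'a list) set"
  for X R where
  rel: "\<lbrakk>(u, v) \<in> R; u \<in> lists X; v \<in> lists X; p \<in> lists X; q \<in> lists X\<rbrakk>
    \<Longrightarrow> (p @ u @ q, p @ v @ q) \<in> word_cong X R"
| refl: "u \<in> lists X \<Longrightarrow> (u, u) \<in> word_cong X R"
| sym: "(u, v) \<in> word_cong X R \<Longrightarrow> (v, u) \<in> word_cong X R"
| trans: "\<lbrakk>(u, v) \<in> word_cong X R; (v, w) \<in> word_cong X R\<rbrakk> \<Longrightarrow> (u, w) \<in> word_cong X R"

text \<open>The monoid with generators \<open>X\<close> and relations \<open>R\<close>. Here and below, functions of congruence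
  classes are lifted from words by taking the union of the classes of the values at all
  representatives, as in \<open>HOL.Equiv_Relations\<close>.\<close>

definition presented_monoid :: "'a set \<Rightarrow> ('a list \<times> 'a list) set \<Rightarrow> 'a list set monoid" where
  "presented_monoid X R =
     \<lparr>carrier = lists X // word_cong X R,
      mult = (\<lambda>a b. \<Union>u\<in>a. \<Union>v\<in>b. word_cong X R `` {u @ v}),
      one = word_cong X R `` {[]}\<rparr>"

definition M_rels :: "'a set \<Rightarrow> ('a \<times> 'a \<Rightarrow> 'a \<times> 'a) \<Rightarrow> ('a list \<times> 'a list) set" where
  "M_rels X r = {([x, y], [lam r x y, rho r y x]) | x y. x \<in> X \<and> y \<in> X}"

definition M_cong :: "'a set \<Rightarrow> ('a \<times> 'a \<Rightarrow> 'a \<times> 'a) \<Rightarrow> ('a list \<times> 'a list) set" where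
  "M_cong X r = word_cong X (M_rels X r)"

definition A_rels :: "'a set \<Rightarrow> ('a \<times> 'a \<Rightarrow> 'a \<times> 'a) \<Rightarrow> ('a list \<times> 'a list) set" where
  "A_rels X r = {([x, y], [y, sigma X r y x]) | x y. x \<in> X \<and> y \<in> X}"

definition A_cong :: "'a set \<Rightarrow> ('a \<times> 'a \<Rightarrow> 'a \<times> 'a) \<Rightarrow> ('a list \<times> 'a list) set" where
  "A_cong X r = word_cong X (A_rels X r)"

definition M_monoid :: "'a set \<Rightarrow> ('a \<times> 'a \<Rightarrow> 'a \<times> 'a) \<Rightarrow> 'a list set monoid" where
  "M_monoid X r = presented_monoid X (M_rels X r)"

definition A_monoid :: "'a set \<Rightarrow> ('a \<times> 'a \<Rightarrow> 'a \<times> 'a) \<Rightarrow> 'a list set monoid" where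
  "A_monoid X r = presented_monoid X (A_rels X r)"

text \<open>The extension of \<open>r\<close> to words. The recursion equations are instances of
  \<open>\<lambda>\<^sub>x(y \<circ> v) = \<lambda>\<^sub>x(y) \<circ> \<lambda>\<^bsub>\<rho>\<^sub>y(x)\<^esub>(v)\<close>, \<open>\<rho>\<^bsub>y \<circ> v\<^esub> = \<rho>\<^sub>v \<rho>\<^sub>y\<close>, \<open>\<lambda>\<^bsub>x \<circ> u\<^esub> = \<lambda>\<^sub>x \<lambda>\<^sub>u\<close> and
  \<open>\<rho>\<^sub>w(x \<circ> u) = \<rho>\<^bsub>\<lambda>\<^sub>u(w)\<^esub>(x) \<circ> \<rho>\<^sub>w(u)\<close>; these determine the extension.
  The equations for products of arbitrary words are proved below.\<close>

fun lam_letter :: "('a \<times> 'a \<Rightarrow> 'a \<times> 'a) \<Rightarrow> 'a \<Rightarrow> 'a list \<Rightarrow> 'a list" where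
  "lam_letter r x [] = []"
| "lam_letter r x (y # v) = lam r x y # lam_letter r (rho r y x) v"

fun rho_letter :: "('a \<times> 'a \<Rightarrow> 'a \<times> 'a) \<Rightarrow> 'a list \<Rightarrow> 'a \<Rightarrow> 'a" where
  "rho_letter r [] x = x"
| "rho_letter r (y # v) x = rho_letter r v (rho r y x)"

fun lam_word :: "('a \<times> 'a \<Rightarrow> 'a \<times> 'a) \<Rightarrow> 'a list \<Rightarrow> 'a list \<Rightarrow> 'a list" where
  "lam_word r [] w = w"
| "lam_word r (x # u) w = lam_letter r x (lam_word r u w)"

fun rho_word :: "('a \<times> 'a \<Rightarrow> 'a \<times> 'a) \<Rightarrow> 'a list \<Rightarrow> 'a list \<Rightarrow> 'a list" where
  "rho_word r w [] = []"
| "rho_word r w (x # u) = rho_letter r (lam_word r u w) x # rho_word r w u"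

lemma lam_word_append: "lam_word r (u @ v) w = lam_word r u (lam_word r v w)"
  by (induction u) auto

lemma rho_word_append_right:
  "rho_word r w (u @ v) = rho_word r (lam_word r v w) u @ rho_word r w v"
  by (induction u) (auto simp: lam_word_append)

lemma lam_letter_append:
  "lam_letter r x (v @ w) = lam_letter r x v @ lam_letter r (rho_letter r v x) w"
  by (induction v arbitrary: x) auto

lemma rho_letter_append: "rho_letter r (v @ w) x = rho_letter r w (rho_letter r v x)"
  by (induction v arbitrary: x) auto

lemma lam_word_append_right:
  "lam_word r u (v @ w) = lam_word r u v @ lam_word r (rho_word r v u) w"
  by (induction u) (auto simp: lam_letter_append)

lemma rho_word_append: "rho_word r (v @ w) u = rho_word r w (rho_word r v u)"
  by (induction u) (auto simp: lam_word_append_right rho_letter_append)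

lemma lam_rho_word_singleton:
  "lam_word r [x] [y] = [lam r x y]" "rho_word r [y] [x] = [rho r y x]"
  by auto

definition r_M :: "'a set \<Rightarrow> ('a \<times> 'a \<Rightarrow> 'a \<times> 'a) \<Rightarrow>
    'a list set \<times> 'a list set \<Rightarrow> 'a list set \<times> 'a list set" where
  "r_M X r = (\<lambda>(a, b).
     (\<Union>u\<in>a. \<Union>v\<in>b. M_cong X r `` {lam_word r u v},
      \<Union>u\<in>a. \<Union>v\<in>b. M_cong X r `` {rho_word r v u}))"

text \<open>The bijective 1-cocycle from \<open>M(X,r)\<close> to \<open>A(X,r)\<close>, computed on words by
  \<open>\<pi>(x \<circ> u) = x \<oplus> \<lambda>\<^sub>x(\<pi>(u))\<close>. On \<open>A(X,r)\<close> the automorphism \<open>\<lambda>\<^sub>x\<close> acts letterwise on words,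
  in contrast to \<open>lam_letter\<close>, which describes \<open>\<lambda>\<^sub>x\<close> on words representing elements of \<open>M(X,r)\<close>.\<close>

fun cocycle_word :: "('a \<times> 'a \<Rightarrow> 'a \<times> 'a) \<Rightarrow> 'a list \<Rightarrow> 'a list" where
  "cocycle_word r [] = []"
| "cocycle_word r (x # u) = x # map (lam r x) (cocycle_word r u)"

definition cocycle :: "'a set \<Rightarrow> ('a \<times> 'a \<Rightarrow> 'a \<times> 'a) \<Rightarrow> 'a list set \<Rightarrow> 'a list set" where
  "cocycle X r a = (\<Union>u\<in>a. A_cong X r `` {cocycle_word r u})"

lemma cocycle_word_append:
  "cocycle_word r (u @ v) = cocycle_word r u @ map (foldr (lam r) u) (cocycle_word r v)"
  by (induction u) auto

text \<open>The monoid \<open>(M,+)\<close>, with \<open>+\<close> transported along the cocycle.\<close>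

definition M_add_monoid :: "'a set \<Rightarrow> ('a \<times> 'a \<Rightarrow> 'a \<times> 'a) \<Rightarrow> 'a list set monoid" where
  "M_add_monoid X r =
     \<lparr>carrier = carrier (M_monoid X r),
      mult = (\<lambda>a b. inv_into (carrier (M_monoid X r)) (cocycle X r)
                (cocycle X r a \<otimes>\<^bsub>A_monoid X r\<^esub> cocycle X r b)),
      one = \<one>\<^bsub>M_monoid X r\<^esub>\<rparr>"

definition M_gen :: "'a set \<Rightarrow> ('a \<times> 'a \<Rightarrow> 'a \<times> 'a) \<Rightarrow> 'a \<Rightarrow> 'a list set" where
  "M_gen X r x = M_cong X r `` {[x]}"

text \<open>\<open>multiple X r k x\<close> is \<open>kx\<close>; the power is taken in a monoid that is written additively.\<close>

definition multiple :: "'a set \<Rightarrow> ('a \<times> 'a \<Rightarrow> 'a \<times> 'a) \<Rightarrow> nat \<Rightarrow> 'a \<Rightarrow> 'a list set" where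
  "multiple X r k x = M_gen X r x [^]\<^bsub>M_add_monoid X r\<^esub> k"

definition cabled :: "'a set \<Rightarrow> ('a \<times> 'a \<Rightarrow> 'a \<times> 'a) \<Rightarrow> nat \<Rightarrow> 'a \<times> 'a \<Rightarrow> 'a \<times> 'a" where
  "cabled X r k =
     map_prod (inv_into X (multiple X r k)) (inv_into X (multiple X r k))
       \<circ> r_M X r \<circ> map_prod (multiple X r k) (multiple X r k)"

end

theory Submission
  imports Defs
begin

text \<open>
  For a biquandle put \<open>T x = \<lambda>\<^sub>x\<inverse>(x)\<close>. The condition \<open>\<sigma>\<^sub>x(x) = x\<close> says exactly that
  \<open>r (x, T x) = (x, T x)\<close>, and the \<open>k\<close>-fold sum of \<open>x\<close> is the product
  \<open>x \<circ> T x \<circ> \<dots> \<circ> T\<^bsup>k-1\<^esup> x\<close>: the cocycle sends this word to \<open>x \<oplus> \<dots> \<oplus> x\<close>.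
  All pairs of neighbouring letters of this word are fixed points of \<open>r\<close>. Such a word, called
  a chain below, admits no non-trivial application of the defining relations of \<open>M(X,r)\<close>, so
  its congruence class is a singleton; for the same reason the class of \<open>x \<oplus> \<dots> \<oplus> x\<close> in
  \<open>A(X,r)\<close> is a singleton. Hence \<open>kx\<close> can be identified with an actual word
  (\<open>multiple_eq\<close>), and the cabled solution becomes a computation with words.

  The Yang--Baxter equation shows that acting on a chain by any word, from either side, gives
  a chain (\<open>chain_lam_word\<close>, \<open>chain_rho_word\<close>). As a chain is determined by its length
  and its first letter, \<open>r\<^bsup>(k)\<^esup>(x, y)\<close> consists of the first letters of the two words
  obtained by letting the chains of \<open>x\<close> and \<open>y\<close> act on each other (\<open>cabled_eq\<close>).
  Finally, applying a morphism letterwise maps chains to chains and commutes with the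
  word actions, so it commutes with \<open>r\<^bsup>(k)\<^esup>\<close>.
\<close>

section \<open>Rigid words\<close>

text \<open>A word that no relation can change, in either direction, is alone in its class. The
  proof shows that being equal to \<open>w\<close> is an invariant of the congruence.\<close>

lemma word_cong_class_rigid:
  assumes "w \<in> lists X"
    and rigid: "\<And>p u v q. (u, v) \<in> R \<Longrightarrow> p @ u @ q = w \<longleftrightarrow> p @ v @ q = w"
  shows "word_cong X R `` {w} = {w}"
proof -
  have "u = w \<longleftrightarrow> v = w" if "(u, v) \<in> word_cong X R" for u v
    using that by induction (use rigid in blast)+
  then show ?thesis
    using assms(1) by (auto intro: word_cong.refl)
qed

section \<open>Chains\<close>

definition chain :: "'a set \<Rightarrow> ('a \<times> 'a \<Rightarrow> 'a \<times> 'a) \<Rightarrow> 'a list \<Rightarrow> bool" where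
  "chain X r w \<longleftrightarrow> w \<in> lists X \<and> successively (\<lambda>a b. r (a, b) = (a, b)) w"

lemma chain_Nil [simp]: "chain X r []"
  by (simp add: chain_def)

lemma chain_Cons:
  "chain X r (x # w) \<longleftrightarrow> x \<in> X \<and> chain X r w \<and> (w \<noteq> [] \<longrightarrow> r (x, hd w) = (x, hd w))"
  by (cases w) (auto simp: chain_def)

lemma solution_closed:
  assumes "solution X r" "x \<in> X" "y \<in> X"
  shows "lam r x y \<in> X" "rho r y x \<in> X"
proof -
  have "r (x, y) \<in> X \<times> X"
    using assms by (auto simp: solution_def dest: bij_betwE)
  then show "lam r x y \<in> X" "rho r y x \<in> X"
    by (auto simp: lam_def rho_def)
qed

lemma r_eq_lam_rho: "r (x, y) = (lam r x y, rho r y x)"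
  by (simp add: lam_def rho_def)

lemma solution_inj:
  assumes "solution X r" "a \<in> X" "b \<in> X" "c \<in> X" "d \<in> X" "r (a, b) = r (c, d)"
  shows "a = c" "b = d"
proof -
  have "inj_on r (X \<times> X)"
    using assms(1) by (auto simp: solution_def bij_betw_def)
  then have "(a, b) = (c, d)"
    using assms by (auto dest: inj_onD)
  then show "a = c" "b = d" by auto
qed

lemma lam_inj:
  assumes "solution X r" "x \<in> X"
  shows "inj_on (lam r x) X"
  using assms by (auto simp: solution_def bij_betw_def)

text \<open>A relation of \<open>M(X,r)\<close> replaces \<open>(a, b)\<close> by \<open>r (a, b)\<close> or conversely. It is trivial at a
  fixed pair \<open>(a, b)\<close>, also in the converse direction: if \<open>r (c, d) = (a, b)\<close>, then
  \<open>r (c, d) = r (a, b)\<close>, and \<open>r\<close> is injective.\<close>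

lemma M_cong_chain:
  assumes "solution X r" "chain X r w"
  shows "M_cong X r `` {w} = {w}"
  unfolding M_cong_def
proof (rule word_cong_class_rigid)
  show "w \<in> lists X"
    using assms(2) by (simp add: chain_def)
  fix p u v q
  assume "(u, v) \<in> M_rels X r"
  then obtain x y where xy: "x \<in> X" "y \<in> X" "u = [x, y]" "v = [lam r x y, rho r y x]"
    by (auto simp: M_rels_def)
  have fixed: "r (a, b) = (a, b)" if "p @ [a, b] @ q = w" for a b
    using assms(2) that by (auto simp: chain_def successively_append_iff)
  show "p @ u @ q = w \<longleftrightarrow> p @ v @ q = w"
  proof
    assume "p @ u @ q = w"
    moreover from this have "r (x, y) = (x, y)" using fixed xy by simp
    ultimately show "p @ v @ q = w"
      using xy by (simp add: lam_def rho_def)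
  next
    assume *: "p @ v @ q = w"
    then have "r (lam r x y, rho r y x) = r (x, y)"
      using fixed[of "lam r x y" "rho r y x"] xy by (simp add: r_eq_lam_rho)
    then have "lam r x y = x" "rho r y x = y"
      using solution_inj[OF assms(1)] solution_closed[OF assms(1)] xy by metis+
    then show "p @ u @ q = w" using * xy by simp
  qed
qed

text \<open>In a chain each letter \<open>a\<close> determines its successor \<open>b\<close>, since \<open>\<lambda>\<^sub>a(b) = a\<close> and \<open>\<lambda>\<^sub>a\<close> is
  injective.\<close>

lemma chain_eqI:
  assumes "solution X r" "chain X r u" "chain X r v" "length u = length v"
    and "u \<noteq> [] \<Longrightarrow> hd u = hd v"
  shows "u = v"
  using assms(4,2,3,5)
proof (induction rule: list_induct2)
  case (Cons x u y v)
  have "hd u = hd v" if "u \<noteq> []"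
  proof (rule inj_onD[OF lam_inj[OF assms(1)]])
    show "x \<in> X" "hd u \<in> X" "hd v \<in> X"
      using Cons.prems Cons.hyps that by (cases u; cases v; auto simp: chain_Cons)+
    have "r (x, hd u) = (x, hd u)" "r (x, hd v) = (x, hd v)"
      using Cons.prems Cons.hyps that by (auto simp: chain_Cons)
    then show "lam r x (hd u) = lam r x (hd v)" by (simp add: lam_def)
  qed
  then show ?case
    using Cons by (auto simp: chain_Cons)
qed simp

section \<open>Words acting on chains\<close>

lemma lists_word_actions:
  assumes "solution X r"
  shows "x \<in> X \<Longrightarrow> v \<in> lists X \<Longrightarrow> lam_letter r x v \<in> lists X"
    and "x \<in> X \<Longrightarrow> v \<in> lists X \<Longrightarrow> rho_letter r v x \<in> X"
    and "u \<in> lists X \<Longrightarrow> v \<in> lists X \<Longrightarrow> lam_word r u v \<in> lists X"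
proof -
  show *: "x \<in> X \<Longrightarrow> v \<in> lists X \<Longrightarrow> lam_letter r x v \<in> lists X" for x v
    by (induction v arbitrary: x) (auto simp: solution_closed[OF assms])
  show "x \<in> X \<Longrightarrow> v \<in> lists X \<Longrightarrow> rho_letter r v x \<in> X"
    by (induction v arbitrary: x) (auto simp: solution_closed[OF assms])
  show "u \<in> lists X \<Longrightarrow> v \<in> lists X \<Longrightarrow> lam_word r u v \<in> lists X"
    by (induction u) (auto simp: *)
qed

lemma length_lam_letter [simp]: "length (lam_letter r x v) = length v"
  by (induction v arbitrary: x) auto

lemma length_lam_word [simp]: "length (lam_word r u v) = length v"
  by (induction u) auto

lemma length_rho_word [simp]: "length (rho_word r v u) = length u"
  by (induction u) auto

text \<open>If \<open>(y, z)\<close> is fixed, then \<open>r\<^sub>2\<^sub>3\<close> fixes \<open>t = (x, y, z)\<close>, and the Yang--Baxter equation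
  at \<open>t\<close> becomes \<open>r\<^sub>1\<^sub>2 t' = t'\<close> for \<open>t' = r\<^sub>2\<^sub>3 (r\<^sub>1\<^sub>2 t)\<close>. Symmetrically, a fixed pair
  \<open>(x, y)\<close> yields a triple fixed by \<open>r\<^sub>2\<^sub>3\<close>.\<close>

lemma fixed_pair_lam:
  assumes "solution X r" "x \<in> X" "y \<in> X" "z \<in> X" "r (y, z) = (y, z)"
  shows "r (lam r x y, lam r (rho r y x) z) = (lam r x y, lam r (rho r y x) z)"
proof -
  have "braid12 r (braid23 r (braid12 r (x, y, z))) = braid23 r (braid12 r (braid23 r (x, y, z)))"
    using assms by (simp add: solution_def)
  then show ?thesis
    using assms(5) by (simp add: braid12_def braid23_def lam_def rho_def split: prod.splits)
qed

lemma fixed_pair_rho: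
  assumes "solution X r" "x \<in> X" "y \<in> X" "z \<in> X" "r (x, y) = (x, y)"
  shows "r (rho r (lam r y z) x, rho r z y) = (rho r (lam r y z) x, rho r z y)"
proof -
  have "braid12 r (braid23 r (braid12 r (x, y, z))) = braid23 r (braid12 r (braid23 r (x, y, z)))"
    using assms by (simp add: solution_def)
  then show ?thesis
    using assms(5) by (simp add: braid12_def braid23_def lam_def rho_def split: prod.splits)
qed

lemma chain_lam_letter:
  assumes "solution X r" "x \<in> X" "chain X r v"
  shows "chain X r (lam_letter r x v)"
  using assms(2,3)
proof (induction v arbitrary: x)
  case (Cons y v)
  have "chain X r (lam_letter r (rho r y x) v)"
    using Cons solution_closed[OF assms(1)] by (simp add: chain_Cons)
  moreover have "r (lam r x y, lam r (rho r y x) z) = (lam r x y, lam r (rho r y x) z)"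
    if "v = z # v'" for z v'
    using fixed_pair_lam[OF assms(1), of x y z] Cons.prems that by (simp add: chain_Cons)
  ultimately show ?case
    using Cons.prems solution_closed[OF assms(1)] by (cases v) (auto simp: chain_Cons)
qed simp

lemma chain_lam_word:
  assumes "solution X r" "u \<in> lists X" "chain X r v"
  shows "chain X r (lam_word r u v)"
  using assms(2) by induction (auto simp: assms chain_lam_letter)

lemma fixed_pair_rho_letter:
  assumes "solution X r" "x \<in> X" "y \<in> X" "r (x, y) = (x, y)" "w \<in> lists X"
  shows "r (rho_letter r (lam_letter r y w) x, rho_letter r w y) =
           (rho_letter r (lam_letter r y w) x, rho_letter r w y)"
  using assms(5,2-4)
proof (induction w arbitrary: x y)
  case (Cons z w)
  then show ?case
    using fixed_pair_rho[OF assms(1), of x y z] solution_closed[OF assms(1)] by simp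
qed simp

lemma chain_rho_word:
  assumes "solution X r" "w \<in> lists X" "chain X r u"
  shows "chain X r (rho_word r w u)"
  using assms(3)
proof (induction u)
  case (Cons x u)
  have "u \<in> lists X" "x \<in> X"
    using Cons.prems by (auto simp: chain_Cons chain_def)
  moreover have
    "r (rho_letter r (lam_letter r y (lam_word r u' w)) x, rho_letter r (lam_word r u' w) y) =
       (rho_letter r (lam_letter r y (lam_word r u' w)) x, rho_letter r (lam_word r u' w) y)"
    if "u = y # u'" for y u'
  proof (rule fixed_pair_rho_letter[OF assms(1)])
    show "x \<in> X" "y \<in> X" "r (x, y) = (x, y)"
      using Cons.prems that by (auto simp: chain_Cons)
    have "u' \<in> lists X"
      using Cons.prems that by (simp add: chain_def)
    then show "lam_word r u' w \<in> lists X"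
      using assms(2) by (rule lists_word_actions(3)[OF assms(1)])
  qed
  ultimately show ?case
    using Cons assms(1,2) by (cases u) (auto simp: chain_Cons lists_word_actions)
qed simp

section \<open>Multiples as chains\<close>

text \<open>This is \<open>x \<circ> T x \<circ> \<dots> \<circ> T\<^bsup>k-1\<^esup> x\<close> with \<open>T x = \<lambda>\<^sub>x\<inverse>(x)\<close>, chosen so that at each step
  the cocycle applies \<open>\<lambda>\<^sub>x\<close> to copies of \<open>T x\<close> and returns copies of \<open>x\<close>.\<close>

fun multiple_word :: "'a set \<Rightarrow> ('a \<times> 'a \<Rightarrow> 'a \<times> 'a) \<Rightarrow> nat \<Rightarrow> 'a \<Rightarrow> 'a list" where
  "multiple_word X r 0 x = []"
| "multiple_word X r (Suc k) x = x # multiple_word X r k (inv_into X (lam r x) x)"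

lemma length_multiple_word [simp]: "length (multiple_word X r k x) = k"
  by (induction k arbitrary: x) auto

lemma hd_multiple_word [simp]: "k > 0 \<Longrightarrow> hd (multiple_word X r k x) = x"
  by (cases k) auto

lemma lam_inv:
  assumes "solution X r" "x \<in> X" "y \<in> X"
  shows "inv_into X (lam r x) y \<in> X" "lam r x (inv_into X (lam r x) y) = y"
proof -
  have "y \<in> lam r x ` X"
    using assms by (auto simp: solution_def bij_betw_def)
  then show "inv_into X (lam r x) y \<in> X" "lam r x (inv_into X (lam r x) y) = y"
    by (simp_all add: inv_into_into f_inv_into_f)
qed

text \<open>With \<open>t = \<lambda>\<^sub>x\<inverse>(x)\<close> the biquandle condition reads \<open>\<lambda>\<^sub>x(\<rho>\<^sub>t(x)) = x = \<lambda>\<^sub>x(t)\<close>.\<close>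

lemma biquandle_fixed:
  assumes "biquandle X r" "x \<in> X"
  shows "r (x, inv_into X (lam r x) x) = (x, inv_into X (lam r x) x)"
proof -
  have sol: "solution X r" and "sigma X r x x = x"
    using assms by (auto simp: biquandle_def)
  let ?t = "inv_into X (lam r x) x"
  note t = lam_inv[OF sol assms(2,2)]
  have "lam r x (rho r ?t x) = lam r x ?t"
    using \<open>sigma X r x x = x\<close> t by (simp add: sigma_def)
  then have "rho r ?t x = ?t"
    by (rule inj_onD[OF lam_inj[OF sol assms(2)]])
      (use t assms(2) in \<open>simp_all add: solution_closed[OF sol]\<close>)
  then show ?thesis using t by (simp add: r_eq_lam_rho)
qed

lemma chain_multiple_word:
  assumes "biquandle X r" "x \<in> X"
  shows "chain X r (multiple_word X r k x)"
  using assms(2)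
proof (induction k arbitrary: x)
  case (Suc k)
  have "solution X r" using assms(1) by (simp add: biquandle_def)
  then have "inv_into X (lam r x) x \<in> X" using Suc.prems by (rule lam_inv) (rule Suc.prems)
  then show ?case
    using Suc biquandle_fixed[OF assms(1) Suc.prems] by (cases k) (auto simp: chain_Cons)
qed simp

lemma chain_eq_multiple_word:
  assumes "biquandle X r" "chain X r w" "w \<noteq> []"
  shows "w = multiple_word X r (length w) (hd w)"
proof (rule chain_eqI)
  show "solution X r" using assms(1) by (simp add: biquandle_def)
  have "hd w \<in> X" using assms(2,3) by (cases w) (auto simp: chain_def)
  then show "chain X r (multiple_word X r (length w) (hd w))"
    by (rule chain_multiple_word[OF assms(1)])
qed (use assms in auto)

lemma cocycle_multiple_word:
  assumes "solution X r" "x \<in> X"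
  shows "cocycle_word r (multiple_word X r k x) = replicate k x"
  using assms(2)
  by (induction k arbitrary: x) (auto simp: lam_inv[OF assms(1)])

lemma lists_cocycle_word:
  assumes "solution X r"
  shows "u \<in> lists X \<Longrightarrow> cocycle_word r u \<in> lists X"
  by (induction u) (auto simp: in_lists_conv_set solution_closed[OF assms])

lemma cocycle_word_inj:
  assumes "solution X r"
  shows "inj_on (cocycle_word r) (lists X)"
proof (rule inj_onI)
  fix u v
  assume "u \<in> lists X" "v \<in> lists X" "cocycle_word r u = cocycle_word r v"
  then show "u = v"
  proof (induction u arbitrary: v)
    case Nil
    then show ?case by (cases v) auto
  next
    case (Cons x u)
    then obtain v' where v: "v = x # v'" "v' \<in> lists X"
        "map (lam r x) (cocycle_word r u) = map (lam r x) (cocycle_word r v')"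
      by (cases v) auto
    have "inj_on (map (lam r x)) (lists X)"
      using lam_inj[OF assms] Cons.hyps by (simp add: inj_on_map_lists)
    then have "cocycle_word r u = cocycle_word r v'"
      using v(3) lists_cocycle_word[OF assms Cons.hyps(2)] lists_cocycle_word[OF assms v(2)]
      by (rule inj_onD)
    then show ?case using Cons.IH v by simp
  qed
qed

lemma sigma_inj:
  assumes sol: "solution X r" and "y \<in> X"
  shows "inj_on (sigma X r y) X"
proof (rule inj_onI)
  fix a b
  assume ab: "a \<in> X" "b \<in> X" "sigma X r y a = sigma X r y b"
  let ?a = "inv_into X (lam r a) y" and ?b = "inv_into X (lam r b) y"
  have inv: "?a \<in> X" "lam r a ?a = y" "?b \<in> X" "lam r b ?b = y"
    using lam_inv[OF sol] assms(2) ab by auto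
  have "rho r ?a a = rho r ?b b"
    by (rule inj_onD[OF lam_inj[OF sol assms(2)]])
      (use ab inv in \<open>simp_all add: sigma_def solution_closed[OF sol]\<close>)
  then have "r (a, ?a) = r (b, ?b)" using inv by (simp add: r_eq_lam_rho)
  then show "a = b" using solution_inj(1)[OF sol ab(1) inv(1) ab(2) inv(3)] by simp
qed

text \<open>As \<open>\<sigma>\<^sub>x\<close> is injective and fixes \<open>x\<close>, the only relation with \<open>x \<oplus> x\<close> on either side is
  the trivial one, \<open>x \<oplus> x = x \<oplus> \<sigma>\<^sub>x(x)\<close>.\<close>

lemma A_cong_replicate:
  assumes "biquandle X r" "x \<in> X"
  shows "A_cong X r `` {replicate k x} = {replicate k x}"
  unfolding A_cong_def
proof (rule word_cong_class_rigid)
  show "replicate k x \<in> lists X" using assms(2) by auto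
  have sol: "solution X r" and quandle: "\<And>x. x \<in> X \<Longrightarrow> sigma X r x x = x"
    using assms(1) by (auto simp: biquandle_def)
  fix p u v q
  assume "(u, v) \<in> A_rels X r"
  then obtain a b where ab: "a \<in> X" "b \<in> X" "u = [a, b]" "v = [b, sigma X r b a]"
    by (auto simp: A_rels_def)
  have eq: "set w \<subseteq> {x}" if "p @ w @ q = replicate k x" for w
    using arg_cong[OF that, of set] by (auto split: if_splits)
  show "p @ u @ q = replicate k x \<longleftrightarrow> p @ v @ q = replicate k x"
  proof
    assume "p @ u @ q = replicate k x"
    moreover from eq[OF this] have "a = x" "b = x" using ab by auto
    ultimately show "p @ v @ q = replicate k x" using ab quandle by simp
  next
    assume *: "p @ v @ q = replicate k x"
    from eq[OF this] have "b = x" "sigma X r x a = sigma X r x x"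
      using ab quandle by auto
    from this(2) ab(1) assms(2) have "a = x"
      by (rule inj_onD[OF sigma_inj[OF sol assms(2)]])
    then show "p @ u @ q = replicate k x" using * ab quandle \<open>b = x\<close> by simp
  qed
qed

text \<open>By induction on \<open>k\<close>: the cocycle of \<open>kx\<close> is the singleton class of \<open>x \<oplus> \<dots> \<oplus> x\<close>, adding
  \<open>x\<close> lengthens this word by one letter, and the inverse of the cocycle leads back to a chain.\<close>

lemma multiple_eq:
  assumes "biquandle X r" "x \<in> X"
  shows "multiple X r k x = {multiple_word X r k x}"
proof -
  have sol: "solution X r" using assms(1) by (simp add: biquandle_def)
  note chain = chain_multiple_word[OF assms]
  have cocycle: "cocycle X r {multiple_word X r n x} = {replicate n x}" for n
    by (simp add: cocycle_def cocycle_multiple_word[OF sol assms(2)] A_cong_replicate[OF assms])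
  have carrier: "{multiple_word X r n x} \<in> carrier (M_monoid X r)" for n
  proof -
    have "multiple_word X r n x \<in> lists X"
      using chain[of n] by (simp add: chain_def)
    then have "M_cong X r `` {multiple_word X r n x} \<in> carrier (M_monoid X r)"
      by (simp add: M_monoid_def M_cong_def presented_monoid_def quotientI)
    then show ?thesis by (simp add: M_cong_chain[OF sol chain])
  qed
  \<comment> \<open>Already as words, only the chain of \<open>x\<close> is sent to \<open>x \<oplus> \<dots> \<oplus> x\<close>; this gives the inverse
    of the cocycle at the one place where it is evaluated.\<close>
  have unique: "a = {multiple_word X r n x}"
    if a: "a \<in> carrier (M_monoid X r)" "cocycle X r a = {replicate n x}" for a n
  proof -
    obtain u where u: "u \<in> lists X" "a = M_cong X r `` {u}"
      using a(1) by (auto simp: M_monoid_def M_cong_def presented_monoid_def quotient_def)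
    have "u \<in> a"
      using u by (simp add: M_cong_def word_cong.refl)
    then have "A_cong X r `` {cocycle_word r u} \<subseteq> cocycle X r a"
      unfolding cocycle_def by (rule UN_upper)
    moreover have "cocycle_word r u \<in> A_cong X r `` {cocycle_word r u}"
      using lists_cocycle_word[OF sol u(1)] by (simp add: A_cong_def word_cong.refl)
    ultimately have "cocycle_word r u \<in> {replicate n x}"
      unfolding a(2) by (rule subsetD)
    then have "cocycle_word r u = cocycle_word r (multiple_word X r n x)"
      by (simp add: cocycle_multiple_word[OF sol assms(2)])
    moreover have "multiple_word X r n x \<in> lists X"
      using chain[of n] by (simp add: chain_def)
    ultimately have "u = multiple_word X r n x"
      using u(1) by (intro inj_onD[OF cocycle_word_inj[OF sol], of u "multiple_word X r n x"])
    then show ?thesis using u(2) by (simp add: M_cong_chain[OF sol chain])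
  qed
  have inverse: "inv_into (carrier (M_monoid X r)) (cocycle X r) {replicate n x} =
      {multiple_word X r n x}" for n
  proof (rule unique)
    have "{replicate n x} \<in> cocycle X r ` carrier (M_monoid X r)"
      using imageI[OF carrier[of n], of "cocycle X r"] unfolding cocycle .
    then show "inv_into (carrier (M_monoid X r)) (cocycle X r) {replicate n x} \<in> carrier (M_monoid X r)"
      "cocycle X r (inv_into (carrier (M_monoid X r)) (cocycle X r) {replicate n x}) = {replicate n x}"
      by (simp_all only: inv_into_into f_inv_into_f)
  qed
  have gen: "M_gen X r x = {multiple_word X r 1 x}"
    using M_cong_chain[OF sol chain[of 1]] by (simp add: M_gen_def)
  show ?thesis
  proof (induction k)
    case 0
    have "M_cong X r `` {[]} = {[]}"
      by (rule M_cong_chain[OF sol]) simp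
    then show ?case
      by (simp add: multiple_def M_add_monoid_def M_monoid_def presented_monoid_def M_cong_def
          nat_pow_def)
  next
    case (Suc k)
    have "A_cong X r `` {replicate k x @ replicate 1 x} = {replicate (Suc k) x}"
      using A_cong_replicate[OF assms, of "k + 1"] by (simp only: replicate_add[symmetric] Suc_eq_plus1)
    then have sum: "{replicate k x} \<otimes>\<^bsub>A_monoid X r\<^esub> {replicate 1 x} = {replicate (Suc k) x}"
      by (simp add: A_monoid_def presented_monoid_def A_cong_def)
    have "multiple X r (Suc k) x =
        multiple X r k x \<otimes>\<^bsub>M_add_monoid X r\<^esub> {multiple_word X r 1 x}"
      by (simp add: multiple_def nat_pow_def gen)
    also have "\<dots> = {multiple_word X r (Suc k) x}"
      unfolding Suc.IH
      by (simp only: M_add_monoid_def monoid.simps cocycle sum inverse)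
    finally show ?case .
  qed
qed

section \<open>The cabled solution\<close>

text \<open>The classes of both words are singletons, so \<open>r\<^sub>M\<close> is evaluated at one pair of
  representatives. Both results of the mutual action are chains of length \<open>k\<close>, hence multiples of their
  first letters.\<close>

lemma cabled_eq:
  assumes "biquandle X r" "k > 0" "x \<in> X" "y \<in> X"
  defines "u \<equiv> multiple_word X r k x" and "v \<equiv> multiple_word X r k y"
  shows "cabled X r k (x, y) = (hd (lam_word r u v), hd (rho_word r v u))"
proof -
  have sol: "solution X r" using assms(1) by (simp add: biquandle_def)
  have uv: "chain X r u" "chain X r v"
    using assms by (auto intro: chain_multiple_word)
  then have lists: "u \<in> lists X" "v \<in> lists X" by (auto simp: chain_def)
  have inj: "inj_on (multiple X r k) X"
  proof (rule inj_onI)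
    fix a b
    assume "a \<in> X" "b \<in> X" "multiple X r k a = multiple X r k b"
    then have "multiple_word X r k a = multiple_word X r k b"
      by (simp add: multiple_eq[OF assms(1)])
    then have "hd (multiple_word X r k a) = hd (multiple_word X r k b)" by simp
    then show "a = b" using assms(2) by simp
  qed
  have hd_class: "inv_into X (multiple X r k) (M_cong X r `` {w}) = hd w"
    if "chain X r w" "length w = k" for w
  proof -
    have "w \<noteq> []" using that assms(2) by auto
    then have "hd w \<in> X" using that(1) by (cases w) (auto simp: chain_def)
    moreover from this have "M_cong X r `` {w} = multiple X r k (hd w)"
      using chain_eq_multiple_word[OF assms(1) that(1) \<open>w \<noteq> []\<close>] that
      by (simp add: M_cong_chain[OF sol] multiple_eq[OF assms(1)])
    ultimately show ?thesis using inj by simp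
  qed
  have "r_M X r (multiple X r k x, multiple X r k y) =
      (M_cong X r `` {lam_word r u v}, M_cong X r `` {rho_word r v u})"
    using assms by (simp add: multiple_eq r_M_def)
  then show ?thesis
    using hd_class[OF chain_lam_word[OF sol lists(1) uv(2)]]
      hd_class[OF chain_rho_word[OF sol lists(2) uv(1)]]
    by (simp add: cabled_def u_def v_def)
qed

section \<open>Morphisms\<close>

lemma morphism_lam_rho:
  assumes "morphism X r Y s f" "x \<in> X" "y \<in> X"
  shows "f (lam r x y) = lam s (f x) (f y)" "f (rho r y x) = rho s (f y) (f x)"
proof -
  have "map_prod f f (r (x, y)) = s (map_prod f f (x, y))"
    using assms by (auto simp: morphism_def)
  then show "f (lam r x y) = lam s (f x) (f y)" "f (rho r y x) = rho s (f y) (f x)"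
    by (simp_all add: lam_def rho_def prod_eq_iff)
qed

lemma morphism_word_actions:
  assumes "solution X r" "morphism X r Y s f"
  shows "u \<in> lists X \<Longrightarrow> v \<in> lists X \<Longrightarrow>
      map f (lam_word r u v) = lam_word s (map f u) (map f v)"
    and "u \<in> lists X \<Longrightarrow> v \<in> lists X \<Longrightarrow>
      map f (rho_word r v u) = rho_word s (map f v) (map f u)"
proof -
  note [simp] = morphism_lam_rho[OF assms(2)] solution_closed[OF assms(1)]
    lists_word_actions[OF assms(1)]
  have lam_letter: "x \<in> X \<Longrightarrow> v \<in> lists X \<Longrightarrow>
      map f (lam_letter r x v) = lam_letter s (f x) (map f v)" for x v
    by (induction v arbitrary: x) auto
  have rho_letter: "x \<in> X \<Longrightarrow> v \<in> lists X \<Longrightarrow>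
      f (rho_letter r v x) = rho_letter s (map f v) (f x)" for x v
    by (induction v arbitrary: x) auto
  show lam_word: "u \<in> lists X \<Longrightarrow> v \<in> lists X \<Longrightarrow>
      map f (lam_word r u v) = lam_word s (map f u) (map f v)" for u v
    by (induction u) (auto simp: lam_letter)
  show "u \<in> lists X \<Longrightarrow> v \<in> lists X \<Longrightarrow>
      map f (rho_word r v u) = rho_word s (map f v) (map f u)"
    by (induction u) (auto simp: rho_letter lam_word)
qed

lemma morphism_chain:
  assumes "morphism X r Y s f" "chain X r w"
  shows "chain Y s (map f w)"
  using assms(2)
proof (induction w)
  case (Cons x w)
  have "s (f x, f y) = (f x, f y)" if "w = y # w'" for y w'
  proof -
    have "x \<in> X" "y \<in> X" "r (x, y) = (x, y)"
      using Cons.prems that by (auto simp: chain_Cons)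
    then show ?thesis
      using assms(1) by (force simp: morphism_def)
  qed
  moreover have "f x \<in> Y"
    using Cons.prems assms(1) by (auto simp: chain_Cons morphism_def)
  ultimately show ?case
    using Cons by (cases w) (auto simp: chain_Cons)
qed simp

text \<open>The image of the chain of \<open>x\<close> is a chain of the same length that starts with \<open>f x\<close>.\<close>

lemma morphism_multiple_word:
  assumes "biquandle X r" "biquandle Y s" "morphism X r Y s f" "x \<in> X"
  shows "map f (multiple_word X r k x) = multiple_word Y s k (f x)"
proof (cases k)
  case (Suc n)
  have "chain Y s (map f (multiple_word X r k x))"
    by (rule morphism_chain[OF assms(3) chain_multiple_word[OF assms(1,4)]])
  from chain_eq_multiple_word[OF assms(2) this] show ?thesis
    by (simp add: Suc)
qed simp

theorem proposition4p5:
  fixes X :: "'a set" and r :: "'a \<times> 'a \<Rightarrow> 'a \<times> 'a"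
    and Y :: "'b set" and s :: "'b \<times> 'b \<Rightarrow> 'b \<times> 'b"
    and f :: "'a \<Rightarrow> 'b" and k :: nat
  assumes "biquandle X r" and "biquandle Y s"
    and "morphism X r Y s f"
    and "k > 0"
  shows "morphism X (cabled X r k) Y (cabled Y s k) f"
proof -
  have sol: "solution X r" using assms(1) by (simp add: biquandle_def)
  have f: "f \<in> X \<rightarrow> Y" using assms(3) by (simp add: morphism_def)
  have "map_prod f f (cabled X r k (x, y)) = cabled Y s k (f x, f y)"
    if "x \<in> X" "y \<in> X" for x y
  proof -
    let ?u = "multiple_word X r k x" and ?v = "multiple_word X r k y"
    have lists: "?u \<in> lists X" "?v \<in> lists X"
      using chain_multiple_word[OF assms(1)] that by (auto simp: chain_def)
    have "length (lam_word r ?u ?v) = k" "length (rho_word r ?v ?u) = k" by simp_all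
    then have "lam_word r ?u ?v \<noteq> []" "rho_word r ?v ?u \<noteq> []"
      using assms(4) by fastforce+
    then have "map_prod f f (cabled X r k (x, y)) =
        (hd (map f (lam_word r ?u ?v)), hd (map f (rho_word r ?v ?u)))"
      using that by (simp add: cabled_eq[OF assms(1,4)] hd_map)
    also have "\<dots> = cabled Y s k (f x, f y)"
      using that f lists cabled_eq[OF assms(2,4), of "f x" "f y"]
      by (simp add: morphism_word_actions[OF sol assms(3)]
          morphism_multiple_word[OF assms(1-3)] Pi_iff)
    finally show ?thesis .
  qed
  then show ?thesis using f by (auto simp: morphism_def)
qed

end
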